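(* Let $F:\mathbb{R}^n\to\mathbb{R}^n$ be strongly semi-smooth and monotone, and assume the solution set $Z^*=\{z\in\mathbb{R}^n: F(z)=0\}$ is nonempty. Let $\{z^k\}_{k\ge 0}$ be an infinite sequence generated by the ASSN algorithm (described in the context) with $d^k\ne 0$ for all $k\ge 0$. Suppose there is a constant $c_1>0$ such that $\|J\|\le c_1$ for every $k\ge 0$ and every $J\in\partial_B F(z^k)$. Then $\{z^k\}$ converges to some point $\bar z$ such that $F(\bar z)=0$.
   Context: $\|\cdot\|_2$ is the Euclidean norm, $\langle\cdot,\cdot\rangle$ the Euclidean inner product, and $\|\cdot\|$ of a matrix is the operator norm. Monotone: $\langle x-y,F(x)-F(y)\rangle\ge 0$ for all $x,y\in\mathbb{R}^n$. For a locally Lipschitz $F$ with set of differentiability points $D_F$, the B-subdifferential is $\partial_BF(x)=\{\lim_{k\to\infty}F'(x^k): x^k\in D_F,\ x^k\to x\}$, and Clarke's generalized Jacobian $\partial F(x)$ is the convex hull of $\partial_BF(x)$. A locally Lipschitz $F$ is strongly semi-smooth at $x$ if it is directionally differentiable at $x$ and $\|F(x+d)-F(x)-Jd\|_2=O(\|d\|_2^2)$ as $d\to 0$, for any $J\in\partial F(x+d)$. $F$ is strongly semi-smooth if this holds at every $x\in\mathbb{R}^n$. ASSN algorithm. Fix parameters $0<\tau<1$, $0<\nu<1$, $0<\eta_1\le\eta_2<1$, $1<\gamma_1<\gamma_2$, $\underline{\lambda}>0$, a starting point $z^0\in\mathbb{R}^n$ and $\lambda_0>\underline{\lambda}$. Set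 the reference point $\bar u=z^0$. At iteration $k=0,1,2,\dots$: 1. Write $F^k=F(z^k)$, select any $J_k\in\partial_BF(z^k)$, and put $\mu_k=\lambda_k\|F^k\|_2$. 2. Choose any $d^k$ solving $(J_k+\mu_kI)d=-F^k$ approximately, in the sense that the residual $r^k:=(J_k+\mu_kI)d^k+F^k$ satisfies $\|r^k\|_2\le\tau\min\{1,\lambda_k\|F^k\|_2\|d^k\|_2\}$. 3. Set $u^k=z^k+d^k$ and $\rho_k=-\langle F(u^k),d^k\rangle/\|d^k\|_2^2$. 4. If $\rho_k\ge\eta_1$ and $\|F(u^k)\|_2\le\nu\|F(\bar u)\|_2$ (Newton step), set $z^{k+1}=u^k$ and then update $\bar u=u^k$. If $\rho_k\ge\eta_1$ and $\|F(u^k)\|_2>\nu\|F(\bar u)\|_2$ (projection step), set $z^{k+1}=z^k-\frac{\langle F(u^k),z^k-u^k\rangle}{\|F(u^k)\|_2^2}F(u^k)$. Otherwise (unsuccessful iteration), set $z^{k+1}=z^k$. In the last two cases $\bar u$ is unchanged. 5. Choose any $\lambda_{k+1}\in(\underline{\lambda},\lambda_k)$ if $\rho_k\ge\eta_2$; any $\lambda_{k+1}\in[\lambda_k,\gamma_1\lambda_k]$ if $\eta_1\le\rho_k<\eta_2$; any $\lambda_{k+1}\in(\gamma_1\lambda_k,\gamma_2\lambda_k]$ otherwise. *)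

theory Defs
  imports "HOL-Analysis.Analysis"
begin

definition monotone_operator :: "('a::real_inner \<Rightarrow> 'a) \<Rightarrow> bool" where
  "monotone_operator F \<longleftrightarrow> (\<forall>x y. (x - y) \<bullet> (F x - F y) \<ge> 0)"

definition locally_lipschitz :: "('a::metric_space \<Rightarrow> 'b::metric_space) \<Rightarrow> bool" where
  "locally_lipschitz F \<longleftrightarrow> (\<forall>x. \<exists>r>0. \<exists>L. L-lipschitz_on (ball x r) F)"

definition directionally_differentiable_at ::
    "('a::real_normed_vector \<Rightarrow> 'b::real_normed_vector) \<Rightarrow> 'a \<Rightarrow> bool" where
  "directionally_differentiable_at F x \<longleftrightarrow>
     (\<forall>h. \<exists>l. ((\<lambda>t. (F (x + t *\<^sub>R h) - F x) /\<^sub>R t) \<longlongrightarrow> l) (at_right 0))"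

text \<open>The limit of Jacobians is taken entrywise, which in finite dimension is convergence
  in any matrix norm.\<close>

definition B_subdifferential :: "(real^'n \<Rightarrow> real^'m) \<Rightarrow> real^'n \<Rightarrow> (real^'n^'m) set" where
  "B_subdifferential F x =
     {J. \<exists>y :: nat \<Rightarrow> real^'n. (\<forall>k. F differentiable (at (y k))) \<and> y \<longlonglongrightarrow> x \<and>
           (\<lambda>k. jacobian F (at (y k))) \<longlonglongrightarrow> J}"

definition clarke_jacobian :: "(real^'n \<Rightarrow> real^'m) \<Rightarrow> real^'n \<Rightarrow> (real^'n^'m) set" where
  "clarke_jacobian F x = convex hull (B_subdifferential F x)"

text \<open>The constant in the \<open>O\<close>-estimate is uniform in the choice of \<open>J\<close>. As \<open>J\<close> may be an
  arbitrary selection depending on \<open>d\<close>, this is the same as asking for the estimate along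
  every selection.\<close>

definition strongly_semismooth_at :: "(real^'n \<Rightarrow> real^'m) \<Rightarrow> real^'n \<Rightarrow> bool" where
  "strongly_semismooth_at F x \<longleftrightarrow>
     directionally_differentiable_at F x \<and>
     (\<exists>C. \<forall>\<^sub>F d in at 0. \<forall>J \<in> clarke_jacobian F (x + d).
        norm (F (x + d) - F x - J *v d) \<le> C * (norm d)\<^sup>2)"

definition strongly_semismooth :: "(real^'n \<Rightarrow> real^'m) \<Rightarrow> bool" where
  "strongly_semismooth F \<longleftrightarrow> locally_lipschitz F \<and> (\<forall>x. strongly_semismooth_at F x)"

definition assn_residual ::
    "(real^'n \<Rightarrow> real^'n) \<Rightarrow> real^'n \<Rightarrow> real^'n^'n \<Rightarrow> real \<Rightarrow> real^'n \<Rightarrow> real^'n" where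
  "assn_residual F z J lam d = (J + (lam * norm (F z)) *\<^sub>R mat 1) *v d + F z"

definition assn_ratio :: "('a::real_inner \<Rightarrow> 'a) \<Rightarrow> 'a \<Rightarrow> 'a \<Rightarrow> real" where
  "assn_ratio F z d = - (F (z + d) \<bullet> d) / (norm d)\<^sup>2"

text \<open>The locale predicate holds iff the given sequences form an infinite run of the algorithm.
  The choices the algorithm leaves open (\<open>J\<close>, \<open>d\<close>, \<open>lam\<close>) are arbitrary sequences subject to
  the stated conditions; \<open>ubar k\<close> is the reference point at the beginning of iteration \<open>k\<close>,
  and the trial point is \<open>z k + d k\<close>.\<close>

locale assn =
  fixes F :: "real^'n \<Rightarrow> real^'n"
    and \<tau> \<nu> \<eta>\<^sub>1 \<eta>\<^sub>2 \<gamma>\<^sub>1 \<gamma>\<^sub>2 lam_min :: real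
    and z :: "nat \<Rightarrow> real^'n"
    and ubar :: "nat \<Rightarrow> real^'n"
    and J :: "nat \<Rightarrow> real^'n^'n"
    and d :: "nat \<Rightarrow> real^'n"
    and lam :: "nat \<Rightarrow> real"
  assumes tau: "0 < \<tau>" "\<tau> < 1"
    and nu: "0 < \<nu>" "\<nu> < 1"
    and eta: "0 < \<eta>\<^sub>1" "\<eta>\<^sub>1 \<le> \<eta>\<^sub>2" "\<eta>\<^sub>2 < 1"
    and gamma: "1 < \<gamma>\<^sub>1" "\<gamma>\<^sub>1 < \<gamma>\<^sub>2"
    and lam_min: "0 < lam_min"
    and lam_0: "lam_min < lam 0"
    and ubar_0: "ubar 0 = z 0"
    and J_mem: "J k \<in> B_subdifferential F (z k)"
    and inexact: "norm (assn_residual F (z k) (J k) (lam k) (d k))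
                    \<le> \<tau> * min 1 (lam k * norm (F (z k)) * norm (d k))"
    and newton_step:
      "\<lbrakk>assn_ratio F (z k) (d k) \<ge> \<eta>\<^sub>1; norm (F (z k + d k)) \<le> \<nu> * norm (F (ubar k))\<rbrakk>
        \<Longrightarrow> z (Suc k) = z k + d k \<and> ubar (Suc k) = z k + d k"
    and projection_step:
      "\<lbrakk>assn_ratio F (z k) (d k) \<ge> \<eta>\<^sub>1; norm (F (z k + d k)) > \<nu> * norm (F (ubar k))\<rbrakk>
        \<Longrightarrow> z (Suc k) = z k - ((F (z k + d k) \<bullet> (z k - (z k + d k))) / (norm (F (z k + d k)))\<^sup>2)
                               *\<^sub>R F (z k + d k)
            \<and> ubar (Suc k) = ubar k"
    and unsuccessful_step:
      "assn_ratio F (z k) (d k) < \<eta>\<^sub>1 \<Longrightarrow> z (Suc k) = z k \<and> ubar (Suc k) = ubar k"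
    and lam_decrease:
      "assn_ratio F (z k) (d k) \<ge> \<eta>\<^sub>2 \<Longrightarrow> lam (Suc k) \<in> {lam_min<..<lam k}"
    and lam_keep:
      "\<lbrakk>\<eta>\<^sub>1 \<le> assn_ratio F (z k) (d k); assn_ratio F (z k) (d k) < \<eta>\<^sub>2\<rbrakk>
        \<Longrightarrow> lam (Suc k) \<in> {lam k..\<gamma>\<^sub>1 * lam k}"
    and lam_increase:
      "assn_ratio F (z k) (d k) < \<eta>\<^sub>1 \<Longrightarrow> lam (Suc k) \<in> {\<gamma>\<^sub>1 * lam k<..\<gamma>\<^sub>2 * lam k}"

end

theory Submission
  imports Defs
begin

text \<open>
  Let \<open>z*\<close> be a zero of \<open>F\<close>. A successful step has \<open>\<eta>\<^sub>1 \<parallel>d\<^sup>k\<parallel> \<le> \<parallel>F(u\<^sup>k)\<parallel>\<close>, so the length of a Newton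
  step is at most a multiple of the amount by which it decreases the reference value \<open>\<parallel>F(ubar)\<parallel>\<close>,
  whereas projection steps are Fejer monotone. Hence \<open>\<parallel>z\<^sup>k - z*\<parallel> + C \<parallel>F(ubar)\<parallel>\<close> is nonincreasing for
  a suitable \<open>C\<close>, and \<open>\<parallel>z\<^sup>k - z*\<parallel>\<close> converges. It remains to see that \<open>F(z\<^sup>k)\<close> comes arbitrarily close
  to \<open>0\<close> infinitely often. If \<open>\<parallel>F(z\<^sup>k)\<parallel> \<ge> \<epsilon>\<close> from some index on, then a large \<open>\<lambda>\<^sub>k\<close> forces \<open>\<rho>\<^sub>k \<ge> \<eta>\<^sub>2\<close>,
  because \<open>F\<close> is Lipschitz on bounded sets; so \<open>\<lambda>\<^sub>k\<close> stays bounded and \<open>\<parallel>d\<^sup>k\<parallel>\<close> stays away from \<open>0\<close>.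
  Every successful step then decreases one of the two convergent quantities by a fixed amount, so
  eventually all steps are unsuccessful and \<open>\<lambda>\<^sub>k\<close> grows geometrically, a contradiction.
\<close>

section \<open>Local Lipschitz continuity, hyperplane projections and Fejer-type convergence\<close>

lemma locally_lipschitz_continuous:
  assumes "locally_lipschitz F"
  shows "isCont F x"
proof -
  obtain r L where "r > 0" "L-lipschitz_on (ball x r) F"
    using assms unfolding locally_lipschitz_def by blast
  then have "continuous_on (ball x r) F"
    by (intro lipschitz_on_continuous_on)
  then show ?thesis
    using \<open>r > 0\<close> by (simp add: continuous_on_eq_continuous_at)
qed

lemma locally_lipschitz_on_compact:
  assumes "locally_lipschitz F" "compact S"
  obtains L where "L-lipschitz_on S F"
proof -
  \<comment> \<open>\<open>F\<close> is read as a time-independent family over the single instant 0,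
    so that the compactness theorem for \<open>local_lipschitz\<close> applies.\<close>
  have "local_lipschitz {0::real} S (\<lambda>_. F)"
  proof (rule local_lipschitzI)
    fix t :: real and x
    obtain r L where rL: "r > 0" "L-lipschitz_on (ball x r) F"
      using assms(1) unfolding locally_lipschitz_def by blast
    have "L-lipschitz_on (cball x (r/2) \<inter> S) F"
      by (rule lipschitz_on_subset[OF rL(2)]) (use rL(1) in auto)
    then show "\<exists>u>0. \<exists>L. \<forall>t\<in>cball t u \<inter> {0}. L-lipschitz_on (cball x u \<inter> S) F"
      using rL(1) by (intro exI[of _ "r/2"]) auto
  qed
  then obtain L where "\<And>t. t \<in> {0::real} \<Longrightarrow> L-lipschitz_on S F"
    using local_lipschitz_compact_implies_lipschitz[of "{0::real}" S "\<lambda>_. F"] assms(2) by auto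
  then show thesis using that by blast
qed

text \<open>The new point is the projection of \<open>x\<close> onto the hyperplane through
  \<open>u\<close> with normal \<open>v\<close>, which separates \<open>x\<close> from
  \<open>s\<close>. Expanding the square, the cross term wins because
  \<open>v \<bullet> (x - s)\<close> is at least \<open>v \<bullet> (x - u)\<close>. For
  \<open>v = 0\<close> the quotients are 0 by convention and the point does not move.\<close>

lemma hyperplane_projection_fejer:
  fixes v x u s :: "'a::real_inner"
  assumes "v \<bullet> (s - u) \<le> 0" "0 \<le> v \<bullet> (x - u)"
  shows "(norm (x - ((v \<bullet> (x - u)) / (norm v)\<^sup>2) *\<^sub>R v - s))\<^sup>2
           \<le> (norm (x - s))\<^sup>2 - (v \<bullet> (x - u) / norm v)\<^sup>2"
proof (cases "v = 0")
  case False
  define a where "a = (v \<bullet> (x - u)) / (norm v)\<^sup>2"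
  have a: "a * (norm v)\<^sup>2 = v \<bullet> (x - u)" "a \<ge> 0"
    using False assms(2) by (auto simp: a_def)
  have sq: "(v \<bullet> (x - u) / norm v)\<^sup>2 = a * (a * (norm v)\<^sup>2)"
    using False by (simp add: a_def power2_eq_square field_simps)
  have "(norm (x - a *\<^sub>R v - s))\<^sup>2 = (norm (x - s))\<^sup>2 - 2 * (a * (v \<bullet> (x - s))) + a * (a * (norm v)\<^sup>2)"
    unfolding power2_norm_eq_inner by (simp add: inner_commute algebra_simps)
  moreover have "a * (a * (norm v)\<^sup>2) \<le> a * (v \<bullet> (x - s))"
    using a assms(1) by (intro mult_left_mono) (auto simp: inner_diff_right)
  ultimately show ?thesis
    unfolding sq a_def[symmetric] by linarith
qed simp

lemma decseq_bounded_below_convergent: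
  fixes X :: "nat \<Rightarrow> real"
  assumes "\<And>n. X (Suc n) \<le> X n" "\<And>n. 0 \<le> X n"
  shows "convergent X"
  using decseq_convergent[of X 0] assms by (metis convergentI decseq_SucI)

lemma convergent_decrement_tendsto_0:
  fixes X :: "nat \<Rightarrow> real"
  assumes "convergent X"
  shows "(\<lambda>n. X n - X (Suc n)) \<longlonglongrightarrow> 0"
proof -
  obtain l where l: "X \<longlonglongrightarrow> l"
    using assms by (auto simp: convergent_def)
  then show ?thesis
    using tendsto_diff[OF l LIMSEQ_Suc[OF l]] by simp
qed

text \<open>Boundedness yields a cluster point along indices where \<open>F\<close> tends to 0, and
  continuity makes it a zero. Applying \<open>conv\<close> to this zero, rather than to the given
  \<open>s\<close>, the whole distance sequence inherits the limit 0 from the subsequence.\<close>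

lemma fejer_convergence:
  fixes z :: "nat \<Rightarrow> 'a::heine_borel" and F :: "'a \<Rightarrow> 'b::real_normed_vector"
  assumes cont: "\<And>x. isCont F x"
    and ex: "F s = 0"
    and conv: "\<And>s. F s = 0 \<Longrightarrow> convergent (\<lambda>k. dist (z k) s)"
    and freq: "\<And>e. 0 < e \<Longrightarrow> \<exists>\<^sub>F k in sequentially. norm (F (z k)) < e"
  shows "\<exists>zbar. z \<longlonglongrightarrow> zbar \<and> F zbar = 0"
proof -
  have "\<forall>n. \<exists>k\<ge>n. norm (F (z k)) < inverse (real (Suc n))"
    using freq by (simp add: frequently_sequentially)
  then obtain \<kappa> where \<kappa>: "\<And>n. n \<le> \<kappa> n" "\<And>n. norm (F (z (\<kappa> n))) < inverse (real (Suc n))"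
    by metis
  have "Bseq (\<lambda>k. dist (z k) s)"
    using conv[OF ex] by (rule convergent_imp_Bseq)
  then obtain B where "\<And>k. dist (z k) s \<le> B"
    unfolding Bseq_def by auto
  then have "bounded (range (z \<circ> \<kappa>))"
    by (auto simp: bounded_def dist_commute intro!: exI[of _ s] exI[of _ B])
  then obtain zbar r where r: "strict_mono r" "(z \<circ> \<kappa> \<circ> r) \<longlonglongrightarrow> zbar"
    using bounded_imp_convergent_subsequence by blast
  have "(\<lambda>n. F (z (\<kappa> n))) \<longlonglongrightarrow> 0"
    by (rule Lim_null_comparison[OF _ LIMSEQ_inverse_real_of_nat])
       (use \<kappa>(2) in \<open>auto intro!: always_eventually less_imp_le\<close>)
  then have "(\<lambda>n. F (z (\<kappa> (r n)))) \<longlonglongrightarrow> 0"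
    using LIMSEQ_subseq_LIMSEQ[OF _ r(1)] by (auto simp: o_def)
  moreover have "(\<lambda>n. F (z (\<kappa> (r n)))) \<longlonglongrightarrow> F zbar"
    using isCont_tendsto_compose[OF cont r(2)] by (simp add: o_def)
  ultimately have zero: "F zbar = 0"
    using LIMSEQ_unique by blast
  obtain l where l: "(\<lambda>k. dist (z k) zbar) \<longlonglongrightarrow> l"
    using conv[OF zero] by (auto simp: convergent_def)
  \<comment> \<open>The choice \<kappa> need not be monotone; \<open>n \<le> \<kappa> n\<close>
    already sends the indices to infinity.\<close>
  have "filterlim (\<lambda>n. \<kappa> (r n)) at_top sequentially"
    by (rule filterlim_compose[OF _ filterlim_subseq[OF r(1)]])
       (rule filterlim_at_top_mono[OF filterlim_ident], use \<kappa>(1) in auto)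
  from filterlim_compose[OF l this] have "(\<lambda>n. dist (z (\<kappa> (r n))) zbar) \<longlonglongrightarrow> l" .
  moreover have "(\<lambda>n. dist (z (\<kappa> (r n))) zbar) \<longlonglongrightarrow> 0"
    using iffD1[OF tendsto_dist_iff r(2)] by (simp add: o_def)
  ultimately have "l = 0"
    using LIMSEQ_unique by blast
  then have "z \<longlonglongrightarrow> zbar"
    using l tendsto_dist_iff by blast
  with zero show ?thesis by blast
qed

lemma norm_diff_diff_le:
  fixes a b c :: "'a::real_normed_vector"
  shows "norm (a - b - c) \<le> norm a + norm b + norm c"
  using norm_triangle_ineq4[of "a - b" c] norm_triangle_ineq4[of a b] by linarith

section \<open>Estimates for a single successful iteration\<close>

locale monotone_assn = assn +
  fixes c\<^sub>1 :: real
  assumes locally_lip: "locally_lipschitz F"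
    and mono: "monotone_operator F"
    and d_nonzero: "\<And>k. d k \<noteq> 0"
    and J_bound: "\<And>k x. norm (J k *v x) \<le> c\<^sub>1 * norm x"
begin

abbreviation "ratio k \<equiv> assn_ratio F (z k) (d k)"

lemma lam_gt: "lam_min < lam k"
proof (induction k)
  case (Suc k)
  have "lam k \<le> \<gamma>\<^sub>1 * lam k"
    using Suc lam_min gamma(1) by simp
  then show ?case
    using Suc lam_decrease[of k] lam_keep[of k] lam_increase[of k] by fastforce
qed (rule lam_0)

lemma lam_pos: "0 < lam k"
  using lam_gt[of k] lam_min by simp

lemma inexact_le:
  "norm (assn_residual F (z k) (J k) (lam k) (d k)) \<le> \<tau> * (lam k * norm (F (z k)) * norm (d k))"
  using inexact[of k] tau(1) by (smt (verit) mult_left_mono)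

lemma norm_d_pos: "0 < norm (d k)"
  using d_nonzero by simp

lemma le_ratio_iff: "a \<le> ratio k \<longleftrightarrow> a * (norm (d k))\<^sup>2 \<le> - (F (z k + d k) \<bullet> d k)"
  unfolding assn_ratio_def using norm_d_pos[of k] by (intro pos_le_divide_eq) simp

lemma successful_inner:
  assumes "\<eta>\<^sub>1 \<le> ratio k"
  shows "\<eta>\<^sub>1 * (norm (d k))\<^sup>2 \<le> - (F (z k + d k) \<bullet> d k)"
  using assms by (simp add: le_ratio_iff)

lemma successful_norm_d_le_trial:
  assumes "\<eta>\<^sub>1 \<le> ratio k"
  shows "\<eta>\<^sub>1 * norm (d k) \<le> norm (F (z k + d k))"
proof -
  have "(\<eta>\<^sub>1 * norm (d k)) * norm (d k) \<le> norm (F (z k + d k)) * norm (d k)"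
    using successful_inner[OF assms] Cauchy_Schwarz_ineq2[of "F (z k + d k)" "d k"]
    by (simp add: power2_eq_square)
  then show ?thesis
    using norm_d_pos[of k] by simp
qed

text \<open>Monotonicity along \<open>d k\<close> allows the trial point in the success test to be
  replaced by the current iterate. This bounds successful steps before anything is known about the
  trial points.\<close>

lemma successful_norm_d_le:
  assumes "\<eta>\<^sub>1 \<le> ratio k"
  shows "\<eta>\<^sub>1 * norm (d k) \<le> norm (F (z k))"
proof -
  have "0 \<le> d k \<bullet> (F (z k + d k) - F (z k))"
    using mono[unfolded monotone_operator_def, rule_format, of "z k + d k" "z k"] by simp
  then have "(\<eta>\<^sub>1 * norm (d k)) * norm (d k) \<le> norm (F (z k)) * norm (d k)"
    using successful_inner[OF assms] Cauchy_Schwarz_ineq2[of "F (z k)" "d k"]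
    by (simp add: power2_eq_square inner_diff_right inner_commute)
  then show ?thesis
    using norm_d_pos[of k] by simp
qed

section \<open>Reference values, projection steps and the Lyapunov function\<close>

lemma norm_F_ubar_newton:
  assumes "\<eta>\<^sub>1 \<le> ratio k" "norm (F (z k + d k)) \<le> \<nu> * norm (F (ubar k))"
  shows "norm (F (ubar (Suc k))) \<le> \<nu> * norm (F (ubar k))"
  using newton_step[OF assms] assms(2) by simp

lemma norm_F_ubar_Suc: "norm (F (ubar (Suc k))) \<le> norm (F (ubar k))"
proof -
  have "\<nu> * norm (F (ubar k)) \<le> norm (F (ubar k))"
    using nu by (simp add: mult_left_le_one_le)
  then show ?thesis
    using norm_F_ubar_newton[of k] projection_step[of k] unsuccessful_step[of k]
    by (smt (verit, best))
qed

text \<open>Monotonicity between \<open>s\<close> and the trial point puts \<open>s\<close> on the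
  far side of the projection hyperplane, and the success test keeps \<open>z k\<close> a quantified
  distance away on the near side.\<close>

lemma projection_decrease:
  assumes "F s = 0" "\<eta>\<^sub>1 \<le> ratio k" "\<nu> * norm (F (ubar k)) < norm (F (z k + d k))"
  shows "(\<eta>\<^sub>1 * (norm (d k))\<^sup>2 / norm (F (z k + d k)))\<^sup>2
           \<le> (norm (z k - s))\<^sup>2 - (norm (z (Suc k) - s))\<^sup>2"
proof -
  let ?u = "z k + d k"
  have sep: "F ?u \<bullet> (s - ?u) \<le> 0"
    using mono[unfolded monotone_operator_def, rule_format, of s ?u] assms(1)
    by (simp add: inner_commute)
  have lower: "\<eta>\<^sub>1 * (norm (d k))\<^sup>2 \<le> F ?u \<bullet> (z k - ?u)"
    using successful_inner[OF assms(2)] by simp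
  have "0 \<le> \<eta>\<^sub>1 * (norm (d k))\<^sup>2"
    using eta(1) by simp
  then have "(\<eta>\<^sub>1 * (norm (d k))\<^sup>2 / norm (F ?u))\<^sup>2 \<le> (F ?u \<bullet> (z k - ?u) / norm (F ?u))\<^sup>2"
    using lower by (intro power_mono divide_right_mono) auto
  moreover have "(norm (z (Suc k) - s))\<^sup>2 \<le> (norm (z k - s))\<^sup>2 - (F ?u \<bullet> (z k - ?u) / norm (F ?u))\<^sup>2"
    using hyperplane_projection_fejer[OF sep, of "z k"] lower projection_step[OF assms(2,3)]
      \<open>0 \<le> \<eta>\<^sub>1 * (norm (d k))\<^sup>2\<close> by simp
  ultimately show ?thesis by linarith
qed

text \<open>A Newton step may move away from \<open>s\<close>, but by at most
  \<open>norm (d k)\<close>, which is at most \<open>\<nu> / \<eta>\<^sub>1\<close> times the old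
  reference value. That value drops by at least its fraction \<open>1 - \<nu>\<close>; the ratio of
  the two factors is \<open>C\<close>.\<close>

lemma lyapunov_Suc:
  assumes "F s = 0"
  defines "C \<equiv> \<nu> / (\<eta>\<^sub>1 * (1 - \<nu>))"
  shows "norm (z (Suc k) - s) + C * norm (F (ubar (Suc k)))
           \<le> norm (z k - s) + C * norm (F (ubar k))"
proof -
  have C: "0 \<le> C"
    using nu eta(1) by (simp add: C_def)
  consider (newton) "\<eta>\<^sub>1 \<le> ratio k" "norm (F (z k + d k)) \<le> \<nu> * norm (F (ubar k))"
    | (projection) "\<eta>\<^sub>1 \<le> ratio k" "\<nu> * norm (F (ubar k)) < norm (F (z k + d k))"
    | (unsuccessful) "ratio k < \<eta>\<^sub>1"
    by linarith
  then show ?thesis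
  proof cases
    case newton
    have "\<eta>\<^sub>1 * norm (d k) \<le> \<nu> * norm (F (ubar k))"
      using successful_norm_d_le_trial[OF newton(1)] newton(2) by linarith
    then have "norm (d k) \<le> \<nu> * norm (F (ubar k)) / \<eta>\<^sub>1"
      using eta(1) by (simp add: pos_le_divide_eq mult.commute)
    also have "\<dots> = C * ((1 - \<nu>) * norm (F (ubar k)))"
      using nu by (simp add: C_def)
    also have "\<dots> = C * (norm (F (ubar k)) - \<nu> * norm (F (ubar k)))"
      by (simp add: left_diff_distrib)
    also have "\<dots> \<le> C * (norm (F (ubar k)) - norm (F (ubar (Suc k))))"
      using norm_F_ubar_newton[OF newton] C by (intro mult_left_mono) auto
    finally have "norm (d k) \<le> C * norm (F (ubar k)) - C * norm (F (ubar (Suc k)))"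
      by (simp add: right_diff_distrib)
    moreover have "norm (z (Suc k) - s) \<le> norm (z k - s) + norm (d k)"
      using newton_step[OF newton] norm_triangle_ineq[of "z k - s" "d k"]
      by (simp add: algebra_simps)
    ultimately show ?thesis by linarith
  next
    case projection
    have "(norm (z (Suc k) - s))\<^sup>2 \<le> (norm (z k - s))\<^sup>2"
      using projection_decrease[OF assms(1) projection]
      by (smt (verit) zero_le_power2)
    then have "norm (z (Suc k) - s) \<le> norm (z k - s)"
      by (rule power2_le_imp_le) simp
    then show ?thesis
      using projection_step[OF projection] by simp
  next
    case unsuccessful
    then show ?thesis
      using unsuccessful_step by simp
  qed
qed

lemma convergent_norm_F_ubar: "convergent (\<lambda>k. norm (F (ubar k)))"
  by (rule decseq_bounded_below_convergent) (use norm_F_ubar_Suc in auto)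

text \<open>The distance itself need not be monotone. It is the difference of the convergent
  Lyapunov function and a multiple of the convergent reference value.\<close>

lemma convergent_dist_zero:
  assumes "F s = 0"
  shows "convergent (\<lambda>k. norm (z k - s))"
proof -
  define C where "C = \<nu> / (\<eta>\<^sub>1 * (1 - \<nu>))"
  have "0 \<le> C"
    using nu eta(1) by (simp add: C_def)
  then have "convergent (\<lambda>k. norm (z k - s) + C * norm (F (ubar k)))"
    by (intro decseq_bounded_below_convergent)
       (use lyapunov_Suc[OF assms, folded C_def] in auto)
  moreover have "convergent (\<lambda>k. C * norm (F (ubar k)))"
    by (intro convergent_mult convergent_const convergent_norm_F_ubar)
  ultimately show ?thesis
    using convergent_diff by fastforce
qed

section \<open>Boundedness, step lengths and the acceptance ratio\<close>

lemma bounded_iterates: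
  assumes "F s = 0"
  obtains R where "0 < R" "\<And>k. norm (z k - s) \<le> R"
  using convergent_imp_Bseq[OF convergent_dist_zero[OF assms]] that
  unfolding Bseq_def by auto

text \<open>The inexact Newton equation is solved for \<open>F (z k)\<close>. With
  \<open>lam\<close> bounded and the residual away from 0, this keeps the steps away from 0.\<close>

lemma norm_F_le:
  "norm (F (z k)) \<le> (c\<^sub>1 + (1 + \<tau>) * (lam k * norm (F (z k)))) * norm (d k)"
proof -
  let ?\<mu> = "lam k * norm (F (z k))"
  let ?r = "assn_residual F (z k) (J k) (lam k) (d k)"
  have "F (z k) = ?r - J k *v d k - ?\<mu> *\<^sub>R d k"
    by (simp add: assn_residual_def matrix_vector_mult_add_rdistrib scaleR_matrix_vector_assoc[symmetric])
  then have "norm (F (z k)) \<le> norm ?r + norm (J k *v d k) + norm (?\<mu> *\<^sub>R d k)"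
    by (metis norm_diff_diff_le)
  also have "norm (?\<mu> *\<^sub>R d k) = ?\<mu> * norm (d k)"
    using lam_pos[of k] by simp
  finally show ?thesis
    using inexact_le[of k] J_bound[of k "d k"] by (simp add: algebra_simps)
qed

text \<open>Here the equation is solved for the regularisation term. The threshold leaves a
  coefficient of at least 1 in front of \<open>norm (d k)\<close> after the inexactness and
  \<open>J k\<close> are absorbed. No success of the step is assumed.\<close>

lemma norm_d_le_of_large_lam:
  assumes "c\<^sub>1 + 1 \<le> (1 - \<tau>) * (lam k * norm (F (z k)))"
  shows "norm (d k) \<le> norm (F (z k))"
proof -
  let ?\<mu> = "lam k * norm (F (z k))"
  let ?r = "assn_residual F (z k) (J k) (lam k) (d k)"
  have "?\<mu> *\<^sub>R d k = ?r - J k *v d k - F (z k)"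
    by (simp add: assn_residual_def matrix_vector_mult_add_rdistrib scaleR_matrix_vector_assoc[symmetric])
  then have "norm (?\<mu> *\<^sub>R d k) \<le> norm ?r + norm (J k *v d k) + norm (F (z k))"
    by (metis norm_diff_diff_le)
  also have "norm (?\<mu> *\<^sub>R d k) = ?\<mu> * norm (d k)"
    using lam_pos[of k] by simp
  finally have "((1 - \<tau>) * ?\<mu> - c\<^sub>1) * norm (d k) \<le> norm (F (z k))"
    using inexact_le[of k] J_bound[of k "d k"] by (simp add: algebra_simps)
  moreover have "1 * norm (d k) \<le> ((1 - \<tau>) * ?\<mu> - c\<^sub>1) * norm (d k)"
    using assms by (intro mult_right_mono) auto
  ultimately show ?thesis by linarith
qed

text \<open>At the trial point, \<open>F\<close> is the residual minus the regularisation term plus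
  the linearisation error \<open>e\<close>. The residual cancels at most the fraction \<tau> of the
  regularisation, and a bound on \<open>e\<close> linear in \<open>norm (d k)\<close>
  suffices.\<close>

lemma ratio_lower_bound:
  assumes "norm (F (z k + d k) - F (z k)) \<le> L * norm (d k)"
  shows "(1 - \<tau>) * (lam k * norm (F (z k))) - (L + c\<^sub>1) \<le> ratio k"
proof -
  let ?\<mu> = "lam k * norm (F (z k))"
  let ?r = "assn_residual F (z k) (J k) (lam k) (d k)"
  define e where "e = F (z k + d k) - F (z k) - J k *v d k"
  have "F (z k + d k) = ?r - ?\<mu> *\<^sub>R d k + e"
    by (simp add: e_def assn_residual_def matrix_vector_mult_add_rdistrib scaleR_matrix_vector_assoc[symmetric])
  then have split: "- (F (z k + d k) \<bullet> d k) = ?\<mu> * (norm (d k))\<^sup>2 - ?r \<bullet> d k - e \<bullet> d k"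
    by (simp add: inner_diff_left inner_add_left power2_norm_eq_inner)
  have "norm e \<le> (L + c\<^sub>1) * norm (d k)"
    using norm_triangle_ineq4[of "F (z k + d k) - F (z k)" "J k *v d k"] assms J_bound[of k "d k"]
    by (simp add: e_def algebra_simps)
  then have e: "e \<bullet> d k \<le> (L + c\<^sub>1) * (norm (d k))\<^sup>2"
    using norm_cauchy_schwarz[of e "d k"] mult_right_mono[of "norm e" _ "norm (d k)"]
    by (fastforce simp: power2_eq_square mult.assoc)
  have r: "?r \<bullet> d k \<le> (\<tau> * ?\<mu>) * (norm (d k))\<^sup>2"
    using norm_cauchy_schwarz[of ?r "d k"] mult_right_mono[OF inexact_le[of k], of "norm (d k)"]
    by (simp add: power2_eq_square mult.assoc)
  have "((1 - \<tau>) * ?\<mu> - (L + c\<^sub>1)) * (norm (d k))\<^sup>2 \<le> - (F (z k + d k) \<bullet> d k)"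
    using split e r by (simp add: algebra_simps)
  then show ?thesis
    by (simp only: le_ratio_iff)
qed

lemma bounded_F_iterates:
  assumes "F s = 0"
  obtains M where "0 < M" "\<And>k. norm (F (z k)) \<le> M"
proof -
  obtain R where R: "\<And>k. norm (z k - s) \<le> R"
    using bounded_iterates[OF assms] by blast
  have "continuous_on (cball s R) F"
    using locally_lipschitz_continuous[OF locally_lip] by (simp add: continuous_at_imp_continuous_on)
  then have "bounded (F ` cball s R)"
    by (intro compact_imp_bounded compact_continuous_image) auto
  then obtain M where "0 < M" "\<And>x. x \<in> cball s R \<Longrightarrow> norm (F x) \<le> M"
    by (auto simp: bounded_pos)
  then show thesis
    using that[of M] R by (simp add: dist_norm norm_minus_commute)
qed

text \<open>Above \<Lambda> the parameter can only decrease; from below \<Lambda> one update exceeds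
  it by at most the factor \<open>\<gamma>\<^sub>2\<close>. Hence the bound
  \<open>B\<close>.\<close>

lemma lam_bounded:
  assumes "F s = 0" "0 < \<epsilon>" and low: "\<And>k. k \<ge> N \<Longrightarrow> \<epsilon> \<le> norm (F (z k))"
  obtains \<Lambda> where "0 < \<Lambda>" "\<And>k. k \<ge> N \<Longrightarrow> lam k \<le> \<Lambda>"
proof -
  obtain R where R: "\<And>k. norm (z k - s) \<le> R"
    using bounded_iterates[OF assms(1)] by blast
  obtain M where M: "0 < M" "\<And>k. norm (F (z k)) \<le> M"
    using bounded_F_iterates[OF assms(1)] by blast
  \<comment> \<open>The radius is fixed before \<Lambda>: a large \<open>lam k\<close> will force
    \<open>norm (d k) \<le> M\<close>, so this ball contains both the iterate and its trial
    point.\<close>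
  obtain L where L: "L-lipschitz_on (cball s (R + M)) F"
    using locally_lipschitz_on_compact[OF locally_lip compact_cball] by blast
  \<comment> \<open>One threshold serves twice: it exceeds the \<open>c\<^sub>1 + 1\<close> needed
    to bound the step, and it makes the lower bound on the ratio at least 1, hence above
    \<open>\<eta>\<^sub>2\<close>.\<close>
  define \<Lambda> where "\<Lambda> = max 1 ((\<bar>L\<bar> + \<bar>c\<^sub>1\<bar> + 1) / ((1 - \<tau>) * \<epsilon>))"
  have decrease: "\<eta>\<^sub>2 \<le> ratio k" if k: "k \<ge> N" "\<Lambda> \<le> lam k" for k
  proof -
    have "(\<bar>L\<bar> + \<bar>c\<^sub>1\<bar> + 1) \<le> lam k * ((1 - \<tau>) * \<epsilon>)"
      using k(2) tau(2) assms(2) by (simp add: \<Lambda>_def pos_divide_le_eq)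
    also have "\<dots> \<le> lam k * ((1 - \<tau>) * norm (F (z k)))"
      using low[OF k(1)] lam_pos[of k] tau(2) by (intro mult_left_mono) auto
    finally have large: "\<bar>L\<bar> + \<bar>c\<^sub>1\<bar> + 1 \<le> (1 - \<tau>) * (lam k * norm (F (z k)))"
      by (simp add: mult_ac)
    then have "norm (d k) \<le> M"
      using norm_d_le_of_large_lam[of k] M(2)[of k] by linarith
    then have "z k \<in> cball s (R + M)" "z k + d k \<in> cball s (R + M)"
      using R[of k] M(1) norm_triangle_ineq[of "z k - s" "d k"]
      by (simp_all add: dist_norm norm_minus_commute algebra_simps)
    then have "norm (F (z k + d k) - F (z k)) \<le> L * norm (d k)"
      using lipschitz_onD[OF L, of "z k + d k" "z k"] by (simp add: dist_norm)
    from ratio_lower_bound[OF this] show ?thesis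
      using large eta(3) by linarith
  qed
  define B where "B = max (lam N) (\<gamma>\<^sub>2 * \<Lambda>)"
  have "lam k \<le> B" if "k \<ge> N" for k
    using that
  proof (induction k rule: dec_induct)
    case base
    then show ?case by (simp add: B_def)
  next
    case (step k)
    show ?case
    proof (cases "\<Lambda> \<le> lam k")
      case True
      then show ?thesis
        using lam_decrease[OF decrease[OF step(1)]] step.IH by auto
    next
      case False
      have "lam (Suc k) \<le> \<gamma>\<^sub>2 * lam k"
      proof -
        have "lam k \<le> \<gamma>\<^sub>2 * lam k" "\<gamma>\<^sub>1 * lam k \<le> \<gamma>\<^sub>2 * lam k"
          using gamma lam_pos[of k] by simp_all
        then show ?thesis
          using lam_decrease[of k] lam_keep[of k] lam_increase[of k] by fastforce
      qed
      also have "\<dots> \<le> \<gamma>\<^sub>2 * \<Lambda>"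
        using False gamma by simp
      finally show ?thesis by (simp add: B_def)
    qed
  qed
  moreover have "0 < B"
    using lam_pos[of N] by (simp add: B_def)
  ultimately show thesis using that by blast
qed

section \<open>Residuals arbitrarily close to 0, and convergence\<close>

lemma lam_unbounded_if_unsuccessful:
  assumes "\<And>k. k \<ge> N \<Longrightarrow> ratio k < \<eta>\<^sub>1"
  shows "\<exists>k\<ge>N. \<Lambda> < lam k"
proof -
  have grow: "\<gamma>\<^sub>1 ^ n * lam N \<le> lam (N + n)" for n
  proof (induction n)
    case (Suc n)
    have "\<gamma>\<^sub>1 ^ Suc n * lam N \<le> \<gamma>\<^sub>1 * lam (N + n)"
      using mult_left_mono[OF Suc, of \<gamma>\<^sub>1] gamma(1) by (simp add: mult.assoc)
    also have "\<dots> \<le> lam (Suc (N + n))"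
      using lam_increase[of "N + n"] assms[of "N + n"] by simp
    finally show ?case by simp
  qed simp
  obtain n where "\<Lambda> / lam N < \<gamma>\<^sub>1 ^ n"
    using real_arch_pow[OF gamma(1)] by blast
  then have "\<Lambda> < lam (N + n)"
    using grow[of n] lam_pos[of N] by (simp add: pos_divide_less_eq)
  then show ?thesis by (intro exI[of _ "N + n"]) simp
qed

text \<open>Success confines the step to length \<open>M' / \<eta>\<^sub>1\<close>, so the trial
  points in question lie in a fixed compact ball.\<close>

lemma trial_points_bounded:
  assumes "F s = 0"
  obtains M where "0 < M" "\<And>k. \<eta>\<^sub>1 \<le> ratio k \<Longrightarrow> norm (F (z k + d k)) \<le> M"
proof -
  obtain R where R: "\<And>k. norm (z k - s) \<le> R"
    using bounded_iterates[OF assms] by blast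
  obtain M' where M': "\<And>k. norm (F (z k)) \<le> M'"
    using bounded_F_iterates[OF assms] by blast
  let ?S = "cball s (R + M' / \<eta>\<^sub>1)"
  have "continuous_on ?S F"
    using locally_lipschitz_continuous[OF locally_lip] by (simp add: continuous_at_imp_continuous_on)
  then have "bounded (F ` ?S)"
    by (intro compact_imp_bounded compact_continuous_image) auto
  then obtain M where M: "0 < M" "\<And>x. x \<in> ?S \<Longrightarrow> norm (F x) \<le> M"
    by (auto simp: bounded_pos)
  have "norm (F (z k + d k)) \<le> M" if "\<eta>\<^sub>1 \<le> ratio k" for k
  proof (rule M(2))
    have "norm (d k) \<le> M' / \<eta>\<^sub>1"
      using successful_norm_d_le[OF that] M'[of k] eta(1) by (simp add: pos_le_divide_eq mult.commute)
    then show "z k + d k \<in> ?S"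
      using R[of k] norm_triangle_ineq[of "z k - s" "d k"]
      by (simp add: dist_norm norm_minus_commute algebra_simps)
  qed
  then show thesis using that M(1) by blast
qed

lemma frequently_small_F:
  assumes "F s = 0" "0 < \<epsilon>"
  shows "\<exists>\<^sub>F k in sequentially. norm (F (z k)) < \<epsilon>"
proof (rule ccontr)
  assume "\<not> ?thesis"
  then obtain N where low: "\<And>k. k \<ge> N \<Longrightarrow> \<epsilon> \<le> norm (F (z k))"
    unfolding not_frequently eventually_sequentially not_less by blast
  obtain \<Lambda> where \<Lambda>: "0 < \<Lambda>" "\<And>k. k \<ge> N \<Longrightarrow> lam k \<le> \<Lambda>"
    using lam_bounded[OF assms low] by blast
  obtain M where M: "0 < M" "\<And>k. norm (F (z k)) \<le> M"
    using bounded_F_iterates[OF assms(1)] by blast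
  obtain M' where M': "0 < M'" "\<And>k. \<eta>\<^sub>1 \<le> ratio k \<Longrightarrow> norm (F (z k + d k)) \<le> M'"
    using trial_points_bounded[OF assms(1)] by blast
  \<comment> \<open>\<open>a\<close> bounds the coefficient in \<open>norm_F_le\<close> from index
    \<open>N\<close> on, so \<delta> is a lower bound for the step lengths.\<close>
  define a where "a = \<bar>c\<^sub>1\<bar> + (1 + \<tau>) * (\<Lambda> * M)"
  define \<delta> where "\<delta> = \<epsilon> / a"
  have a: "0 < a"
    using tau \<Lambda>(1) M(1) by (simp add: a_def add_nonneg_pos)
  then have \<delta>: "0 < \<delta>"
    using assms(2) by (simp add: \<delta>_def)
  have d_low: "\<delta> \<le> norm (d k)" if "k \<ge> N" for k
  proof -
    have "lam k * norm (F (z k)) \<le> \<Lambda> * M"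
      using \<Lambda> M(2)[of k] that lam_pos[of k] by (intro mult_mono) auto
    then have "c\<^sub>1 + (1 + \<tau>) * (lam k * norm (F (z k))) \<le> a"
      unfolding a_def using tau(1) by (intro add_mono mult_left_mono) auto
    then have "\<epsilon> \<le> a * norm (d k)"
      using low[OF that] norm_F_le[of k] mult_right_mono[of _ a "norm (d k)"] by fastforce
    then show ?thesis
      using a by (simp add: \<delta>_def pos_divide_le_eq mult.commute)
  qed
  have "(\<lambda>k. norm (F (ubar k)) - norm (F (ubar (Suc k)))) \<longlonglongrightarrow> 0"
    by (rule convergent_decrement_tendsto_0[OF convergent_norm_F_ubar])
  \<comment> \<open>The least drop of the reference value in a Newton step from index
    \<open>N\<close> on.\<close>
  moreover have "0 < (1 - \<nu>) * \<epsilon>"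
    using nu assms(2) by simp
  ultimately have ev1: "\<forall>\<^sub>F k in sequentially. norm (F (ubar k)) - norm (F (ubar (Suc k))) < (1 - \<nu>) * \<epsilon>"
    by (rule order_tendstoD(2))
  have "convergent (\<lambda>k. (norm (z k - s))\<^sup>2)"
    using convergent_dist_zero[OF assms(1)] by (auto simp: convergent_def intro: tendsto_power)
  from convergent_decrement_tendsto_0[OF this]
  have "(\<lambda>k. (norm (z k - s))\<^sup>2 - (norm (z (Suc k) - s))\<^sup>2) \<longlonglongrightarrow> 0" .
  \<comment> \<open>The least drop of the squared distance in a projection step from index
    \<open>N\<close> on.\<close>
  moreover have "0 < (\<eta>\<^sub>1 * \<delta>\<^sup>2 / M')\<^sup>2"
    using eta(1) \<delta> M'(1) by simp
  ultimately have ev2: "\<forall>\<^sub>F k in sequentially.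
      (norm (z k - s))\<^sup>2 - (norm (z (Suc k) - s))\<^sup>2 < (\<eta>\<^sub>1 * \<delta>\<^sup>2 / M')\<^sup>2"
    by (rule order_tendstoD(2))
  have "\<forall>\<^sub>F k in sequentially. ratio k < \<eta>\<^sub>1"
    using ev1 ev2 eventually_ge_at_top[of N]
  proof eventually_elim
    case (elim k)
    show ?case
    proof (rule ccontr)
      assume "\<not> ?case"
      then have succ: "\<eta>\<^sub>1 \<le> ratio k" by simp
      show False
      proof (cases "norm (F (z k + d k)) \<le> \<nu> * norm (F (ubar k))")
        case True
        \<comment> \<open>The point \<open>ubar k\<close> may date from before \<open>N\<close>,
          where \<open>low\<close> says nothing. The new reference point is
          \<open>z (Suc k)\<close>, and the bound passes back to \<open>ubar k\<close> because
          reference values never increase.\<close>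
        have "\<epsilon> \<le> norm (F (ubar (Suc k)))"
          using newton_step[OF succ True] low[of "Suc k"] elim(3) by simp
        then have "(1 - \<nu>) * \<epsilon> \<le> (1 - \<nu>) * norm (F (ubar k))"
          using norm_F_ubar_Suc[of k] nu by (intro mult_left_mono) auto
        then show False
          using norm_F_ubar_newton[OF succ True] elim(1) by (simp add: algebra_simps)
      next
        case False
        then have proj: "\<nu> * norm (F (ubar k)) < norm (F (z k + d k))" by simp
        have "0 < norm (F (z k + d k))"
          using proj nu by (smt (verit) mult_nonneg_nonneg norm_ge_zero)
        then have "\<eta>\<^sub>1 * \<delta>\<^sup>2 / M' \<le> \<eta>\<^sub>1 * (norm (d k))\<^sup>2 / norm (F (z k + d k))"
          using d_low[OF elim(3)] \<delta> eta(1) M'(2)[OF succ]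
          by (intro frac_le mult_left_mono power_mono) auto
        then have "(\<eta>\<^sub>1 * \<delta>\<^sup>2 / M')\<^sup>2 \<le> (\<eta>\<^sub>1 * (norm (d k))\<^sup>2 / norm (F (z k + d k)))\<^sup>2"
          using eta(1) M'(1) by (intro power_mono) auto
        then show False
          using projection_decrease[OF assms(1) succ proj] elim(2) by linarith
      qed
    qed
  qed
  then obtain K where "\<And>k. k \<ge> K \<Longrightarrow> ratio k < \<eta>\<^sub>1"
    by (auto simp: eventually_sequentially)
  \<comment> \<open>Geometric growth of \<open>lam\<close> starts after \<open>K\<close>, while the
    bound \<Lambda> holds only from \<open>N\<close> on.\<close>
  then obtain k where "k \<ge> max K N" "\<Lambda> < lam k"
    using lam_unbounded_if_unsuccessful[of "max K N" \<Lambda>] by auto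
  then show False
    using \<Lambda>(2)[of k] by simp
qed

theorem convergent_to_zero:
  assumes "F s = 0"
  shows "\<exists>zbar. z \<longlonglongrightarrow> zbar \<and> F zbar = 0"
proof (rule fejer_convergence[where F = F and s = s])
  show "convergent (\<lambda>k. dist (z k) s)" if "F s = 0" for s
    using convergent_dist_zero[OF that] by (simp add: dist_norm)
qed (fact assms frequently_small_F[OF assms] locally_lipschitz_continuous[OF locally_lip])+

end

theorem theorem3p10:
  fixes F :: "real^'n \<Rightarrow> real^'n"
    and \<tau> \<nu> \<eta>\<^sub>1 \<eta>\<^sub>2 \<gamma>\<^sub>1 \<gamma>\<^sub>2 lam_min c\<^sub>1 :: real
    and z ubar d :: "nat \<Rightarrow> real^'n"
    and J :: "nat \<Rightarrow> real^'n^'n"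
    and lam :: "nat \<Rightarrow> real"
  assumes "strongly_semismooth F"
    and "monotone_operator F"
    and "{x. F x = 0} \<noteq> {}"
    and "assn F \<tau> \<nu> \<eta>\<^sub>1 \<eta>\<^sub>2 \<gamma>\<^sub>1 \<gamma>\<^sub>2 lam_min z ubar J d lam"
    and "\<And>k. d k \<noteq> 0"
    and "c\<^sub>1 > 0"
    and "\<And>k A. A \<in> B_subdifferential F (z k) \<Longrightarrow> onorm ((*v) A) \<le> c\<^sub>1"
  shows "\<exists>zbar. z \<longlonglongrightarrow> zbar \<and> F zbar = 0"
proof -
  interpret assn F \<tau> \<nu> \<eta>\<^sub>1 \<eta>\<^sub>2 \<gamma>\<^sub>1 \<gamma>\<^sub>2 lam_min z ubar J d lam
    by (rule assms(4))
  interpret monotone_assn F \<tau> \<nu> \<eta>\<^sub>1 \<eta>\<^sub>2 \<gamma>\<^sub>1 \<gamma>\<^sub>2 lam_min z ubar J d lam c\<^sub>1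
  proof unfold_locales
    show "norm (J k *v x) \<le> c\<^sub>1 * norm x" for k x
    proof -
      have "norm (J k *v x) \<le> onorm ((*v) (J k)) * norm x"
        by (rule onorm[OF matrix_vector_mul_bounded_linear])
      also have "\<dots> \<le> c\<^sub>1 * norm x"
        using assms(7)[OF J_mem] by (rule mult_right_mono) simp
      finally show ?thesis .
    qed
  qed (use assms in \<open>auto simp: strongly_semismooth_def\<close>)
  obtain s where "F s = 0"
    using assms(3) by blast
  then show ?thesis
    by (rule convergent_to_zero)
qed

end
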